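(* $\vdash_{\mathrm{S4}}\neg\Box\sigma$, where $\sigma:=\langle T\le\mathrm{Fr}\rangle\wedge\bigwedge_{d\in D}(\langle T=d\rangle\to\sigma_d)$ and $\sigma_d:=\langle T=d\rangle\wedge\neg\Box\langle T\le d\rangle$.
   Context: Modal formulas are built from variables $X_1,\dots,X_5$ and $\bot$ using $\to$ and $\Box$ (usual derived connectives; $\Diamond\varphi:=\neg\Box\neg\varphi$). Kripke models $\mathcal{M}=(W,E,V)$ with truth defined as usual ($\Box\varphi$ holds at $w$ iff $\varphi$ holds at all $E$-successors of $w$). Throughout, the axiom $(\mathrm{Ax}_{\le1})=\bigwedge_{1\le i<j\le5}(\neg X_i\vee\neg X_j)$ is tacitly assumed. $\vdash_{\mathrm{S4}}\varphi$ means $\varphi$ is provable in modal system S4 (system K plus all instances of $\Box\varphi\to\varphi$ and $\Box\varphi\to\Box\Box\varphi$) with $(\mathrm{Ax}_{\le1})$ as additional axiom; equivalently, $\varphi$ holds in every world of every Kripke model with reflexive and transitive $E$ in which $(\mathrm{Ax}_{\le1})$ holds at every world. Let $R=\{\mathrm{Mo},\mathrm{Tu},\mathrm{We},\mathrm{Th},\mathrm{Fr},\mathrm{none}\}$ with $\mathrm{Mo}<\dots<\mathrm{Fr}<\mathrm{none}$, $D=\{\mathrm{Mo},\dots,\mathrm{Fr}\}$; $Y_{\mathrm{Mo}}=X_1,\dots,Y_{\mathrm{Fr}}=X_5$, $Y_{\mathrm{none}}=\neg(X_1\vee\dots\vee X_5)$. For $B\subseteq R$: $\langle T\in B\rangle:=\bigvee_{r\in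 B}Y_r$, $\langle T=r\rangle:=Y_r$, $\langle T\le d\rangle:=\langle T\in\{r\in R:r\le d\}\rangle$. *)

theory Defs
  imports Main
begin

datatype pvar = X1 | X2 | X3 | X4 | X5

datatype fm =
    Var pvar
  | Bot (\<open>\<^bold>\<bottom>\<close>)
  | Imp fm fm (infixr \<open>\<^bold>\<rightarrow>\<close> 55)
  | Box fm (\<open>\<^bold>\<box>_\<close> [80] 80)

definition Neg :: "fm \<Rightarrow> fm" (\<open>\<^bold>\<not>_\<close> [80] 80) where
  "\<^bold>\<not>\<phi> = (\<phi> \<^bold>\<rightarrow> \<^bold>\<bottom>)"

definition Or :: "fm \<Rightarrow> fm \<Rightarrow> fm" (infixr \<open>\<^bold>\<or>\<close> 60) where
  "\<phi> \<^bold>\<or> \<psi> = (\<^bold>\<not>\<phi> \<^bold>\<rightarrow> \<psi>)"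

definition And :: "fm \<Rightarrow> fm \<Rightarrow> fm" (infixr \<open>\<^bold>\<and>\<close> 65) where
  "\<phi> \<^bold>\<and> \<psi> = \<^bold>\<not>(\<phi> \<^bold>\<rightarrow> \<^bold>\<not>\<psi>)"

fun Disj :: "fm list \<Rightarrow> fm" where
  "Disj [] = \<^bold>\<bottom>"
| "Disj [\<phi>] = \<phi>"
| "Disj (\<phi> # \<psi> # \<chi>s) = \<phi> \<^bold>\<or> Disj (\<psi> # \<chi>s)"

fun Conj :: "fm list \<Rightarrow> fm" where
  "Conj [] = \<^bold>\<not>\<^bold>\<bottom>"
| "Conj [\<phi>] = \<phi>"
| "Conj (\<phi> # \<psi> # \<chi>s) = \<phi> \<^bold>\<and> Conj (\<psi> # \<chi>s)"

definition pvars :: "pvar list" where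
  "pvars = [X1, X2, X3, X4, X5]"

definition Ax_le1 :: fm where
  "Ax_le1 = Conj [\<^bold>\<not>Var (pvars ! i) \<^bold>\<or> \<^bold>\<not>Var (pvars ! j). i \<leftarrow> [0..<5], j \<leftarrow> [Suc i..<5]]"

text \<open>Propositional tautologies: variables and boxed formulas are the atoms.\<close>

primrec peval :: "(fm \<Rightarrow> bool) \<Rightarrow> fm \<Rightarrow> bool" where
  "peval v (Var x) \<longleftrightarrow> v (Var x)"
| "peval v \<^bold>\<bottom> \<longleftrightarrow> False"
| "peval v (\<phi> \<^bold>\<rightarrow> \<psi>) \<longleftrightarrow> (peval v \<phi> \<longrightarrow> peval v \<psi>)"
| "peval v (\<^bold>\<box>\<phi>) \<longleftrightarrow> v (\<^bold>\<box>\<phi>)"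

definition tautology :: "fm \<Rightarrow> bool" where
  "tautology \<phi> \<longleftrightarrow> (\<forall>v. peval v \<phi>)"

text \<open>There is no substitution rule: all axioms but \<open>Ax_le1\<close> are schemes, and \<open>Ax_le1\<close> concerns
  the specific five variables. Necessitation applies to \<open>Ax_le1\<close> as to any other axiom.\<close>

inductive S4_provable :: "fm \<Rightarrow> bool" (\<open>\<turnstile>\<^sub>S\<^sub>4 _\<close> [50] 50) where
  Taut: "tautology \<phi> \<Longrightarrow> \<turnstile>\<^sub>S\<^sub>4 \<phi>"
| AxK: "\<turnstile>\<^sub>S\<^sub>4 \<^bold>\<box>(\<phi> \<^bold>\<rightarrow> \<psi>) \<^bold>\<rightarrow> \<^bold>\<box>\<phi> \<^bold>\<rightarrow> \<^bold>\<box>\<psi>"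
| AxT: "\<turnstile>\<^sub>S\<^sub>4 \<^bold>\<box>\<phi> \<^bold>\<rightarrow> \<phi>"
| Ax4: "\<turnstile>\<^sub>S\<^sub>4 \<^bold>\<box>\<phi> \<^bold>\<rightarrow> \<^bold>\<box>\<^bold>\<box>\<phi>"
| AxLe1: "\<turnstile>\<^sub>S\<^sub>4 Ax_le1"
| MP: "\<turnstile>\<^sub>S\<^sub>4 \<phi> \<^bold>\<rightarrow> \<psi> \<Longrightarrow> \<turnstile>\<^sub>S\<^sub>4 \<phi> \<Longrightarrow> \<turnstile>\<^sub>S\<^sub>4 \<psi>"
| Nec: "\<turnstile>\<^sub>S\<^sub>4 \<phi> \<Longrightarrow> \<turnstile>\<^sub>S\<^sub>4 \<^bold>\<box>\<phi>"

datatype res = Mo | Tu | We | Th | Fr | none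

primrec rank :: "res \<Rightarrow> nat" where
  "rank Mo = 0"
| "rank Tu = 1"
| "rank We = 2"
| "rank Th = 3"
| "rank Fr = 4"
| "rank none = 5"

instantiation res :: linorder
begin

definition less_eq_res :: "res \<Rightarrow> res \<Rightarrow> bool" where
  "r \<le> s \<longleftrightarrow> rank r \<le> rank s"

definition less_res :: "res \<Rightarrow> res \<Rightarrow> bool" where
  "r < s \<longleftrightarrow> rank r < rank s"

instance
proof
  fix r s :: res
  assume "r \<le> s" "s \<le> r"
  then have "rank r = rank s" by (simp add: less_eq_res_def)
  then show "r = s" by (cases r; cases s) simp_all
qed (auto simp: less_eq_res_def less_res_def)

end

definition days :: "res list" where
  "days = [Mo, Tu, We, Th, Fr]"

definition results :: "res list" where
  "results = days @ [none]"

primrec Y :: "res \<Rightarrow> fm" where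
  "Y Mo = Var X1"
| "Y Tu = Var X2"
| "Y We = Var X3"
| "Y Th = Var X4"
| "Y Fr = Var X5"
| "Y none = \<^bold>\<not>Disj (map Var pvars)"

definition T_in :: "res set \<Rightarrow> fm" where
  "T_in B = Disj (map Y (filter (\<lambda>r. r \<in> B) results))"

definition T_eq :: "res \<Rightarrow> fm" where
  "T_eq r = Y r"

definition T_le :: "res \<Rightarrow> fm" where
  "T_le d = T_in {r. r \<le> d}"

definition \<sigma>_day :: "res \<Rightarrow> fm" where
  "\<sigma>_day d = T_eq d \<^bold>\<and> \<^bold>\<not>\<^bold>\<box>T_le d"

definition \<sigma> :: fm where
  "\<sigma> = T_le Fr \<^bold>\<and> Conj (map (\<lambda>d. T_eq d \<^bold>\<rightarrow> \<sigma>_day d) days)"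

end

theory Submission
  imports Defs
begin

text \<open>Backward induction on the days. If \<open>\<box>\<sigma>\<close> and \<open>\<box>\<langle>T \<le> d\<rangle>\<close> hold, then \<open>T = d\<close> is refuted at every
  accessible world, since there \<open>\<sigma>\<close> would yield \<open>\<not>\<box>\<langle>T \<le> d\<rangle>\<close>; hence \<open>\<box>\<langle>T < d\<rangle>\<close>. Starting from
  \<open>\<box>\<langle>T \<le> Fr\<rangle>\<close>, all days are eliminated and \<open>\<box>\<bottom>\<close> remains, which is refuted by reflexivity.\<close>

lemma peval_Neg [simp]: "peval v (\<^bold>\<not>\<phi>) \<longleftrightarrow> \<not> peval v \<phi>"
  by (simp add: Neg_def)

lemma peval_Or [simp]: "peval v (\<phi> \<^bold>\<or> \<psi>) \<longleftrightarrow> peval v \<phi> \<or> peval v \<psi>"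
  by (auto simp: Or_def)

lemma peval_And [simp]: "peval v (\<phi> \<^bold>\<and> \<psi>) \<longleftrightarrow> peval v \<phi> \<and> peval v \<psi>"
  by (simp add: And_def)

lemma peval_Disj [simp]: "peval v (Disj \<phi>s) \<longleftrightarrow> (\<exists>\<phi>\<in>set \<phi>s. peval v \<phi>)"
  by (induction \<phi>s rule: Disj.induct) auto

lemma peval_Conj [simp]: "peval v (Conj \<phi>s) \<longleftrightarrow> (\<forall>\<phi>\<in>set \<phi>s. peval v \<phi>)"
  by (induction \<phi>s rule: Conj.induct) auto

lemma set_results: "set results = UNIV"
proof -
  have "r \<in> set results" for r
    by (cases r) (simp_all add: results_def days_def)
  then show ?thesis
    by auto
qed

lemma peval_T_in [simp]: "peval v (T_in B) \<longleftrightarrow> (\<exists>r\<in>B. peval v (Y r))"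
  by (auto simp: T_in_def set_results)

text \<open>Replaces object-level propositional derivations by a semantic check: valuations treat
  boxed formulas as atoms, so the implication is a tautology.\<close>

lemma S4_taut_mp:
  assumes "\<turnstile>\<^sub>S\<^sub>4 \<phi>" and "\<And>v. peval v \<phi> \<Longrightarrow> peval v \<psi>"
  shows "\<turnstile>\<^sub>S\<^sub>4 \<psi>"
  using assms by (intro MP[OF Taut assms(1)]) (simp add: tautology_def)

lemma S4_taut_mp2:
  assumes "\<turnstile>\<^sub>S\<^sub>4 \<phi>" "\<turnstile>\<^sub>S\<^sub>4 \<psi>" and "\<And>v. peval v \<phi> \<Longrightarrow> peval v \<psi> \<Longrightarrow> peval v \<chi>"
  shows "\<turnstile>\<^sub>S\<^sub>4 \<chi>"
proof (rule MP)
  show "\<turnstile>\<^sub>S\<^sub>4 \<psi> \<^bold>\<rightarrow> \<chi>"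
    by (rule S4_taut_mp[OF assms(1)]) (simp add: assms(3))
qed fact

lemma S4_Box_mono:
  assumes "\<turnstile>\<^sub>S\<^sub>4 \<phi> \<^bold>\<rightarrow> \<psi>"
  shows "\<turnstile>\<^sub>S\<^sub>4 \<^bold>\<box>\<phi> \<^bold>\<rightarrow> \<^bold>\<box>\<psi>"
  by (rule MP[OF AxK Nec[OF assms]])

text \<open>Axiom 4 makes \<box>\<psi> available under the box: \<box>\<phi> yields
  \<box>\<box>\<psi>, and the second premise, boxed and distributed by K, turns this into
  \<box>\<chi>.\<close>

lemma S4_Box_cut:
  assumes "\<turnstile>\<^sub>S\<^sub>4 \<^bold>\<box>\<phi> \<^bold>\<rightarrow> \<^bold>\<box>\<psi>" and "\<turnstile>\<^sub>S\<^sub>4 \<phi> \<^bold>\<rightarrow> \<^bold>\<box>\<psi> \<^bold>\<rightarrow> \<chi>"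
  shows "\<turnstile>\<^sub>S\<^sub>4 \<^bold>\<box>\<phi> \<^bold>\<rightarrow> \<^bold>\<box>\<chi>"
proof -
  have "\<turnstile>\<^sub>S\<^sub>4 \<^bold>\<box>\<phi> \<^bold>\<rightarrow> \<^bold>\<box>\<^bold>\<box>\<psi>"
    by (rule S4_taut_mp2[OF assms(1) Ax4[of \<psi>]]) auto
  moreover have "\<turnstile>\<^sub>S\<^sub>4 \<^bold>\<box>\<phi> \<^bold>\<rightarrow> \<^bold>\<box>\<^bold>\<box>\<psi> \<^bold>\<rightarrow> \<^bold>\<box>\<chi>"
    by (rule S4_taut_mp2[OF S4_Box_mono[OF assms(2)] AxK]) auto
  ultimately show ?thesis
    by (rule S4_taut_mp2) auto
qed

lemma eliminate_day:
  assumes "d \<in> set days" and "\<turnstile>\<^sub>S\<^sub>4 \<^bold>\<box>\<sigma> \<^bold>\<rightarrow> \<^bold>\<box>T_le d"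
  shows "\<turnstile>\<^sub>S\<^sub>4 \<^bold>\<box>\<sigma> \<^bold>\<rightarrow> \<^bold>\<box>T_in {r. r < d}"
proof (rule S4_Box_cut[OF assms(2)])
  show "\<turnstile>\<^sub>S\<^sub>4 \<sigma> \<^bold>\<rightarrow> \<^bold>\<box>T_le d \<^bold>\<rightarrow> T_in {r. r < d}"
  proof (rule S4_taut_mp[OF AxT[of "T_le d"]])
    fix v
    assume T: "peval v (\<^bold>\<box>T_le d \<^bold>\<rightarrow> T_le d)"
    have "peval v (T_in {r. r < d})" if "peval v \<sigma>" and box: "v (\<^bold>\<box>T_le d)"
    proof -
      obtain r where r: "r \<le> d" "peval v (Y r)"
        using T box by (auto simp: T_le_def)
      have "\<not> peval v (Y d)"
        using that assms(1) by (auto simp: \<sigma>_def \<sigma>_day_def T_eq_def)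
      then have "r < d"
        using r by (auto simp: order_less_le)
      then show ?thesis
        using r by auto
    qed
    then show "peval v (\<sigma> \<^bold>\<rightarrow> \<^bold>\<box>T_le d \<^bold>\<rightarrow> T_in {r. r < d})"
      by simp
  qed
qed

text \<open>Links consecutive rounds of the elimination: the strict bound left by one day is the
  weak bound required for the day before. Below \<open>Mo\<close> nothing remains.\<close>

lemma less_res_iff:
  "r < Fr \<longleftrightarrow> r \<le> Th" "r < Th \<longleftrightarrow> r \<le> We" "r < We \<longleftrightarrow> r \<le> Tu" "r < Tu \<longleftrightarrow> r \<le> Mo" "\<not> r < Mo"
  for r :: res
  by (auto simp: less_res_def less_eq_res_def)

theorem theorem6p16: "\<turnstile>\<^sub>S\<^sub>4 \<^bold>\<not>\<^bold>\<box>\<sigma>"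
proof -
  have "\<turnstile>\<^sub>S\<^sub>4 \<^bold>\<box>\<sigma> \<^bold>\<rightarrow> \<^bold>\<box>T_le Fr"
    by (rule S4_Box_mono, rule Taut) (simp add: tautology_def \<sigma>_def)
  from eliminate_day[OF _ this] have "\<turnstile>\<^sub>S\<^sub>4 \<^bold>\<box>\<sigma> \<^bold>\<rightarrow> \<^bold>\<box>T_le Th"
    by (simp add: days_def less_res_iff T_le_def)
  from eliminate_day[OF _ this] have "\<turnstile>\<^sub>S\<^sub>4 \<^bold>\<box>\<sigma> \<^bold>\<rightarrow> \<^bold>\<box>T_le We"
    by (simp add: days_def less_res_iff T_le_def)
  from eliminate_day[OF _ this] have "\<turnstile>\<^sub>S\<^sub>4 \<^bold>\<box>\<sigma> \<^bold>\<rightarrow> \<^bold>\<box>T_le Tu"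
    by (simp add: days_def less_res_iff T_le_def)
  from eliminate_day[OF _ this] have "\<turnstile>\<^sub>S\<^sub>4 \<^bold>\<box>\<sigma> \<^bold>\<rightarrow> \<^bold>\<box>T_le Mo"
    by (simp add: days_def less_res_iff T_le_def)
  from eliminate_day[OF _ this] have "\<turnstile>\<^sub>S\<^sub>4 \<^bold>\<box>\<sigma> \<^bold>\<rightarrow> \<^bold>\<box>T_in {}"
    by (simp add: days_def less_res_iff)
  from this AxT[of "T_in {}"] show ?thesis
    by (rule S4_taut_mp2) auto
qed

end
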